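(* There exists a constant $C_0>0$ such that $$\int_0^1 |g(x)|^L\,dx\le C_0^L L^L$$ for all $L\in\mathbb{N}$.
   Context: For real $u$, $\{u\}$ denotes the fractional part of $u$. The function $g$ is defined by $$g(x)=\sum_{l\ge 1}\frac{1-2\{lx\}}{l},$$ wherever this series converges (it converges for almost every $x\in[0,1]$). *)

theory Defs
  imports "HOL-Analysis.Analysis"
begin

definition g_term :: "real \<Rightarrow> nat \<Rightarrow> real" where
  "g_term x l = (1 - 2 * frac (real l * x)) / real l"

text \<open>
  The series starts at \<open>l = 1\<close> and converges only conditionally in general, so it is summed
  in the natural order of the index. It converges for almost every \<open>x\<close>; the value \<open>0\<close> on the
  remaining null set is a convention that does not affect integrals.
\<close>

definition g_fun :: "real \<Rightarrow> real" where
  "g_fun x = (if summable (\<lambda>l. g_term x (Suc l)) then (\<Sum>l. g_term x (Suc l)) else 0)"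

lemma g_term_measurable [measurable]: "(\<lambda>x. g_term x l) \<in> borel_measurable borel"
  unfolding g_term_def frac_def by measurable

lemma g_fun_measurable [measurable]: "g_fun \<in> borel_measurable borel"
proof -
  have "{x \<in> space borel. Cauchy (\<lambda>n. \<Sum>l<n. g_term x (Suc l))} \<in> sets borel"
    by measurable
  then have [measurable]: "Measurable.pred borel (\<lambda>x. summable (\<lambda>l. g_term x (Suc l)))"
    by (simp add: pred_def summable_iff_convergent Cauchy_convergent_iff)
  show ?thesis
    unfolding g_fun_def[abs_def] by measurable
qed

end

theory Submission
  imports Defs "HOL-Number_Theory.Cong"
begin

text \<open>
  Split the series into dyadic blocks \<open>T j\<close>, where \<open>l\<close> ranges over \<open>2 ^ j \<le> l < 2 ^ (j + 1)\<close>.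
  Each block is bounded by \<open>1\<close>. Writing \<open>saw u = 1 - 2 * frac u\<close>, the functions \<open>saw (l x)\<close>
  and \<open>saw (m x)\<close> have correlation at most \<open>gcd(l, m)\<^sup>2 / (l m)\<close> on the unit interval, so the
  integral of \<open>(T j)\<^sup>2\<close> is at most \<open>8 / 2 ^ j\<close>, and for \<open>L \<ge> 2\<close> this also bounds the integral of
  \<open>\<bar>T j\<bar> ^ L\<close>. Hence the \<open>L\<close>-norm of \<open>T j\<close> decays like \<open>2 powr (- j / L)\<close>, and the sum of these
  norms over \<open>j\<close> is \<open>O(L)\<close>.
\<close>

section \<open>The sawtooth function and its sums over equally spaced shifts\<close>

text \<open>This is -2 times the first periodic Bernoulli function, with value 1 at the integers;
  with that value the identity \<open>saw_sum_shifts\<close> holds at every point.\<close>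

definition saw :: "real \<Rightarrow> real" where
  "saw u = 1 - 2 * frac u"

lemma saw_measurable [measurable]: "saw \<in> borel_measurable borel"
  unfolding saw_def[abs_def] frac_def by measurable

lemma abs_saw_le: "\<bar>saw u\<bar> \<le> 1"
  using frac_ge_0[of u] frac_lt_1[of u] by (simp add: saw_def abs_le_iff)

lemma saw_add_of_nat: "saw (u + real n) = saw u"
  by (simp add: saw_def frac_def)

lemma g_term_eq_saw: "g_term x l = saw (real l * x) / real l"
  by (simp add: g_term_def saw_def)

text \<open>Coprimality allows \<open>n\<close> to be cancelled modulo \<open>q\<close>, so the map
  is injective on a finite set. The offset \<open>j\<close> is an integer because it will be a
  floor, possibly negative.\<close>

lemma bij_betw_affine_mod:
  fixes j :: int
  assumes "q > 0" "coprime n q"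
  shows "bij_betw (\<lambda>k. nat ((j + int n * int k) mod int q)) {..<q} {..<q}"
proof -
  have "inj_on (\<lambda>k. nat ((j + int n * int k) mod int q)) {..<q}"
  proof (rule inj_onI)
    fix k k' assume k: "k \<in> {..<q}" "k' \<in> {..<q}"
      and eq: "nat ((j + int n * int k) mod int q) = nat ((j + int n * int k') mod int q)"
    have "[j + int n * int k = j + int n * int k'] (mod int q)"
      using eq assms(1) by (simp add: cong_def nat_eq_iff)
    then have "[int n * int k = int n * int k'] (mod int q)"
      by (simp add: cong_add_lcancel)
    then have "[int k = int k'] (mod int q)"
      using assms(2) by (simp add: cong_mult_lcancel)
    then show "k = k'"
      using k by (simp add: cong_int_iff cong_less_modulus_unique_nat)
  qed
  moreover have "(\<lambda>k. nat ((j + int n * int k) mod int q)) ` {..<q} \<subseteq> {..<q}"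
    using assms(1) by (auto simp: nat_less_iff)
  ultimately show ?thesis
    by (simp add: bij_betw_def endo_inj_surj)
qed

text \<open>The multiplication formula for the first Bernoulli polynomial. Modulo 1, the shifted
  points are exactly the numbers (i + \<theta>) / q with i < q, where \<theta> is the fractional
  part of q y; their order is irrelevant to the sum.\<close>

lemma saw_sum_shifts:
  assumes "q > 0" "coprime n q"
  shows "(\<Sum>k<q. saw (y + real n * real k / real q)) = saw (real q * y)"
proof -
  define j where "j = \<lfloor>real q * y\<rfloor>"
  define \<theta> where "\<theta> = frac (real q * y)"
  define p where "p k = nat ((j + int n * int k) mod int q)" for k
  have \<theta>: "0 \<le> \<theta>" "\<theta> < 1" "real q * y = real_of_int j + \<theta>"
    unfolding \<theta>_def by (auto simp: frac_lt_1) (simp add: j_def frac_def)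
  have fr: "frac (y + real n * real k / real q) = (real (p k) + \<theta>) / real q" for k
  proof -
    define s where "s = j + int n * int k"
    have p: "int (p k) = s mod int q"
      using assms(1) by (simp add: p_def s_def)
    \<comment> \<open>Together with \<theta> < 1 this puts (p k + \<theta>) / q below 1, so it is
      its own fractional part.\<close>
    then have pq: "real (p k) + 1 \<le> real q"
      using assms(1) by (metis of_nat_0_less_iff of_nat_Suc of_nat_le_iff of_nat_less_iff
          pos_mod_bound Suc_leI add.commute)
    have "s = int q * (s div int q) + int (p k)"
      unfolding p by simp
    then have s: "real_of_int s = real q * real_of_int (s div int q) + real (p k)"
      by (metis of_int_add of_int_mult of_int_of_nat_eq)
    have "y + real n * real k / real q = (real_of_int s + \<theta>) / real q"
      using assms(1) \<theta>(3) by (simp add: s_def field_simps)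
    also have "\<dots> = (real (p k) + \<theta>) / real q + real_of_int (s div int q)"
      using assms(1) unfolding s by (simp add: field_simps)
    finally have "frac (y + real n * real k / real q) = frac ((real (p k) + \<theta>) / real q)"
      by (simp add: frac_def)
    also have "\<dots> = (real (p k) + \<theta>) / real q"
      using assms(1) \<theta> pq by (simp add: frac_eq field_simps)
    finally show ?thesis .
  qed
  have "(\<Sum>k<q. frac (y + real n * real k / real q)) = (\<Sum>k<q. (real (p k) + \<theta>) / real q)"
    by (simp only: fr)
  also have "\<dots> = (\<Sum>i<q. (real i + \<theta>) / real q)"
    using sum.reindex_bij_betw[OF bij_betw_affine_mod[OF assms, of j], of "\<lambda>i. (real i + \<theta>) / real q"]
    by (simp add: p_def)
  also have "\<dots> = ((\<Sum>i<q. real i) + real q * \<theta>) / real q"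
    by (simp add: sum_divide_distrib[symmetric] sum.distrib)
  also have "(\<Sum>i<q. real i) = real q * (real q - 1) / 2"
    by (induction q) (auto simp: field_simps)
  also have "(real q * (real q - 1) / 2 + real q * \<theta>) / real q = (real q - 1) / 2 + \<theta>"
    using assms(1) by (simp add: field_simps)
  finally have "(\<Sum>k<q. frac (y + real n * real k / real q)) = (real q - 1) / 2 + \<theta>" .
  then show ?thesis
    by (simp add: saw_def sum_subtractf sum_distrib_left[symmetric] \<theta>_def diff_divide_distrib)
qed

section \<open>Correlations of dilated sawtooth functions\<close>

lemma integrable_indicator_bounded:
  fixes f :: "real \<Rightarrow> real"
  assumes [measurable]: "f \<in> borel_measurable borel" and "\<And>x. \<bar>f x\<bar> \<le> B"
  shows "integrable lborel (\<lambda>x. indicator {a..<b} x * f x)"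
proof -
  have "integrable lborel (\<lambda>x. indicator {a..<b} x *\<^sub>R f x)"
    by (rule integrableI_bounded_set_indicator[where B=B]) (use assms emeasure_bounded_finite[OF bounded_Ico, of a b] in auto)
  then show ?thesis by simp
qed

lemma integral_periodic_shift:
  fixes f :: "real \<Rightarrow> real"
  assumes [measurable]: "f \<in> borel_measurable borel" and bd: "\<And>x. \<bar>f x\<bar> \<le> B"
    and per: "\<And>x. f (x + 1) = f x" and c: "0 \<le> c" "c \<le> 1"
  shows "(\<integral>x. indicator {0..<1} x * f (x + c) \<partial>lborel) = (\<integral>x. indicator {0..<1} x * f x \<partial>lborel)"
proof -
  note int = integrable_indicator_bounded[OF assms(1) bd]
  have shift: "(\<integral>x. indicator {u..<v} x * f (x + t) \<partial>lborel) =
      (\<integral>x. indicator {u + t..<v + t} x * f x \<partial>lborel)" for u v t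
    using lborel_integral_real_affine[of 1 "\<lambda>x. indicator {u + t..<v + t} x * f x" t]
    by (simp add: indicator_def add.commute)
  \<comment> \<open>The translated interval [c, 1 + c) is cut at 1, and its right piece is moved
    back by one period. The endpoint stays in the form \<open>0 + 1\<close> so that
    \<open>shift\<close> can be applied backwards.\<close>
  have "(\<integral>x. indicator {0..<1} x * f (x + c) \<partial>lborel) =
      (\<integral>x. indicator {c..<1} x * f x + indicator {0 + 1..<c + 1} x * f x \<partial>lborel)"
    using c unfolding shift by (intro Bochner_Integration.integral_cong) (auto simp: indicator_def)
  also have "\<dots> = (\<integral>x. indicator {c..<1} x * f x \<partial>lborel) + (\<integral>x. indicator {0..<c} x * f x \<partial>lborel)"
    by (subst Bochner_Integration.integral_add[OF int int]) (simp only: shift[symmetric] per)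
  also have "\<dots> = (\<integral>x. indicator {c..<1} x * f x + indicator {0..<c} x * f x \<partial>lborel)"
    by (simp only: Bochner_Integration.integral_add[OF int int])
  also have "\<dots> = (\<integral>x. indicator {0..<1} x * f x \<partial>lborel)"
    using c by (intro Bochner_Integration.integral_cong) (auto simp: indicator_def)
  finally show ?thesis .
qed

text \<open>Averaging over the translations by \<open>k / a\<close>, which fix the first factor.\<close>

lemma integral_saw_mult_average:
  assumes "a > 0" "q > 0" "q \<le> a" "coprime n q" "a * n = b * q"
  shows "(\<integral>x. indicator {0..<1} x * (saw (real a * x) * saw (real b * x)) \<partial>lborel) =
    (\<integral>x. indicator {0..<1} x * (saw (real a * x) * saw (real (q * b) * x)) \<partial>lborel) / real q"
proof -
  define f where "f x = saw (real a * x) * saw (real b * x)" for x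
  have f_meas: "f \<in> borel_measurable borel"
    unfolding f_def[abs_def] by measurable
  have f_bound: "\<bar>f x\<bar> \<le> 1" for x
    unfolding f_def abs_mult by (intro mult_le_one abs_saw_le abs_ge_zero)
  have f_periodic: "f (x + 1) = f x" for x
    using saw_add_of_nat[of "real a * x" a] saw_add_of_nat[of "real b * x" b]
    by (simp add: f_def algebra_simps)
  \<comment> \<open>The assumption \<open>q \<le> a\<close> keeps k / a in [0, 1], as
    \<open>integral_periodic_shift\<close> requires.\<close>
  have shift: "(\<integral>x. indicator {0..<1} x * f (x + real k / real a) \<partial>lborel) =
      (\<integral>x. indicator {0..<1} x * f x \<partial>lborel)" if "k < q" for k
    by (rule integral_periodic_shift[where B=1]) (use that assms f_meas f_bound f_periodic in auto)
  have int: "integrable lborel (\<lambda>x. indicator {0..<1} x * f (x + c))" for c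
    by (rule integrable_indicator_bounded[where B=1]) (use f_meas f_bound in auto)
  \<comment> \<open>Hence translating x by k / a moves b x by n k / q, the shifts summed in
    \<open>saw_sum_shifts\<close>.\<close>
  have ratio: "real b / real a = real n / real q"
    using assms by (simp add: field_simps) (metis of_nat_mult)
  have sum: "(\<Sum>k<q. f (x + real k / real a)) = saw (real a * x) * saw (real (q * b) * x)" for x
  proof -
    have "f (x + real k / real a) = saw (real a * x) * saw (real b * x + real n * real k / real q)" for k
    proof -
      have "real a * (x + real k / real a) = real a * x + real k"
        using assms by (simp add: field_simps)
      moreover have "real b * (x + real k / real a) = real b * x + (real b / real a) * real k"
        by (simp add: algebra_simps)
      ultimately show ?thesis
        by (simp add: f_def saw_add_of_nat ratio)
    qed
    then show ?thesis
      using saw_sum_shifts[OF assms(2,4), of "real b * x"]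
      by (simp add: sum_distrib_left[symmetric] mult.assoc)
  qed
  have "real q * (\<integral>x. indicator {0..<1} x * f x \<partial>lborel) =
      (\<Sum>k<q. \<integral>x. indicator {0..<1} x * f (x + real k / real a) \<partial>lborel)"
    by (simp add: shift)
  also have "\<dots> = (\<integral>x. (\<Sum>k<q. indicator {0..<1} x * f (x + real k / real a)) \<partial>lborel)"
    by (rule Bochner_Integration.integral_sum[symmetric]) (rule int)
  also have "\<dots> = (\<integral>x. indicator {0..<1} x * (saw (real a * x) * saw (real (q * b) * x)) \<partial>lborel)"
    by (simp add: sum_distrib_left[symmetric] sum)
  finally show ?thesis
    using assms(2) by (simp add: f_def field_simps)
qed

lemma integral_indicator_le_1:
  fixes f :: "real \<Rightarrow> real"
  assumes "f \<in> borel_measurable borel" "\<And>x. \<bar>f x\<bar> \<le> 1"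
  shows "(\<integral>x. indicator {0..<1} x * f x \<partial>lborel) \<le> 1"
proof -
  have "(\<integral>x. indicator {0..<1} x * f x \<partial>lborel) \<le> (\<integral>x. indicator {0..<1} (x::real) * 1 \<partial>lborel)"
  proof (rule Bochner_Integration.integral_mono)
    show "integrable lborel (\<lambda>x::real. indicator {0..<1} x * f x)"
      by (rule integrable_indicator_bounded) fact+
    show "integrable lborel (\<lambda>x::real. indicator {0..<1} x * (1 :: real))"
      by (rule integrable_indicator_bounded[where B=1]) auto
    show "indicator {0..<1} x * f x \<le> indicator {0..<1} x * 1" for x :: real
      using assms(2)[of x] by (auto simp: indicator_def)
  qed
  then show ?thesis by simp
qed

text \<open>Two averagings replace both frequencies by the least common multiple of l and m, gaining
  the factors 1 / m' and 1 / l', where l = d l', m = d m' and d is the gcd. The product of these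
  factors is d^2 / (l m).\<close>

lemma integral_saw_mult_le:
  assumes "l > 0" "m > 0"
  shows "(\<integral>x. indicator {0..<1} x * (saw (real l * x) * saw (real m * x)) \<partial>lborel)
    \<le> (real (gcd l m))\<^sup>2 / (real l * real m)"
proof -
  define d where "d = gcd l m"
  obtain l' m' where lm: "l = d * l'" "m = d * m'" and cop: "coprime l' m'"
    using gcd_coprime_exists[of l m] assms unfolding d_def by (metis gcd_eq_0_iff mult.commute not_less0)
  have pos: "d > 0" "l' > 0" "m' > 0"
    using assms lm by auto
  have le: "m' \<le> m" "l' \<le> m' * l"
    using pos unfolding lm by (auto intro: order_trans[of _ "d * l'"])
  have "(\<integral>x. indicator {0..<1} x * (saw (real l * x) * saw (real m * x)) \<partial>lborel) =
      (\<integral>x. indicator {0..<1} x * (saw (real m * x) * saw (real l * x)) \<partial>lborel)"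
    by (simp add: mult.commute)
  also have "\<dots> = (\<integral>x. indicator {0..<1} x * (saw (real m * x) * saw (real (m' * l) * x)) \<partial>lborel) / real m'"
    by (rule integral_saw_mult_average[where n=l']) (use assms pos le cop in \<open>auto simp: lm\<close>)
  also have "\<dots> = (\<integral>x. indicator {0..<1} x * (saw (real (m' * l) * x) * saw (real m * x)) \<partial>lborel) / real m'"
    by (simp add: mult.commute)
  \<comment> \<open>Now the first frequency m' l equals l' m, a multiple of the second, so the
    coprimality condition is trivial with \<open>n = 1\<close>.\<close>
  also have "\<dots> = (\<integral>x. indicator {0..<1} x * (saw (real (m' * l) * x) * saw (real (l' * m) * x)) \<partial>lborel) / real l' / real m'"
    by (subst integral_saw_mult_average[where n=1 and q=l']) (use assms pos le in \<open>auto simp: lm\<close>)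
  \<comment> \<open>Both factors now have the same frequency. The integral of the square is 1/3, but
    the bound 1 suffices.\<close>
  also have "\<dots> \<le> 1 / real l' / real m'"
  proof (intro divide_right_mono integral_indicator_le_1)
    show "\<bar>saw (real (m' * l) * x) * saw (real (l' * m) * x)\<bar> \<le> 1" for x
      unfolding abs_mult by (intro mult_le_one abs_saw_le abs_ge_zero)
  qed auto
  also have "\<dots> = (real d)\<^sup>2 / (real l * real m)"
    using pos by (simp add: lm power2_eq_square)
  finally show ?thesis unfolding d_def .
qed

section \<open>A mean value of squared greatest common divisors\<close>

text \<open>The square of a gcd is at most the sum of d^2 over all common divisors d. After
  interchanging sums, each d up to n contributes the square of d times the number of its multiples
  up to n, which is at most n^2.\<close>

lemma sum_gcd_squares_le:
  "(\<Sum>l\<in>{1..n}. \<Sum>m\<in>{1..n}. (real (gcd l m))\<^sup>2) \<le> real n ^ 3"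
proof -
  have gcd_le: "(real (gcd l m))\<^sup>2 \<le> (\<Sum>d\<in>{1..n}. if d dvd l \<and> d dvd m then (real d)\<^sup>2 else 0)"
    if "l \<in> {1..n}" for l m :: nat
  proof -
    have "gcd l m > 0" "gcd l m \<le> n"
      using that by (auto intro: order_trans[OF gcd_le1_nat])
    then have "gcd l m \<in> {1..n}"
      by (simp add: Suc_le_eq)
    then show ?thesis
      using member_le_sum[of "gcd l m" "{1..n}" "\<lambda>d. if d dvd l \<and> d dvd m then (real d)\<^sup>2 else 0"]
      by simp
  qed
  have count: "real d * (\<Sum>l\<in>{1..n}. if d dvd l then 1 else 0) \<le> real n" if "d \<in> {1..n}" for d
  proof -
    have "{l \<in> {1..n}. d dvd l} \<subseteq> (\<lambda>i. d * i) ` {1..n div d}"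
    proof
      fix l assume "l \<in> {l \<in> {1..n}. d dvd l}"
      then obtain i where "l = d * i" "1 \<le> d * i" "d * i \<le> n" by auto
      moreover from this have "i \<in> {1..n div d}"
        using that by (auto simp: less_eq_div_iff_mult_less_eq mult.commute Suc_le_eq)
      ultimately show "l \<in> (\<lambda>i. d * i) ` {1..n div d}" by blast
    qed
    then have "card {l \<in> {1..n}. d dvd l} \<le> n div d"
      using surj_card_le[of "{1..n div d}"] by simp
    then have "d * card {l \<in> {1..n}. d dvd l} \<le> n"
      by (meson mult_le_mono2 order_trans times_div_less_eq_dividend)
    then have "real d * real (card {l \<in> {1..n}. d dvd l}) \<le> real n"
      by (metis of_nat_le_iff of_nat_mult)
    then show ?thesis
      by (simp add: sum.If_cases Int_def)
  qed
  have "(\<Sum>l\<in>{1..n}. \<Sum>m\<in>{1..n}. (real (gcd l m))\<^sup>2) \<le>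
      (\<Sum>l\<in>{1..n}. \<Sum>m\<in>{1..n}. \<Sum>d\<in>{1..n}. if d dvd l \<and> d dvd m then (real d)\<^sup>2 else 0)"
    by (intro sum_mono gcd_le)
  also have "\<dots> = (\<Sum>l\<in>{1..n}. \<Sum>d\<in>{1..n}. \<Sum>m\<in>{1..n}. if d dvd l \<and> d dvd m then (real d)\<^sup>2 else 0)"
    by (intro sum.cong refl sum.swap)
  also have "\<dots> = (\<Sum>d\<in>{1..n}. \<Sum>l\<in>{1..n}. \<Sum>m\<in>{1..n}. if d dvd l \<and> d dvd m then (real d)\<^sup>2 else 0)"
    by (rule sum.swap)
  \<comment> \<open>The conditions on l and m are independent for fixed d, so the double sum factors
    into a square.\<close>
  also have "\<dots> = (\<Sum>d\<in>{1..n}. (real d * (\<Sum>l\<in>{1..n}. if d dvd l then 1 else 0))\<^sup>2)"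
    unfolding power2_eq_square sum_distrib_left sum_distrib_right
    by (intro sum.cong refl) auto
  also have "\<dots> \<le> (\<Sum>d\<in>{1..n}. (real n)\<^sup>2)"
    by (intro sum_mono power_mono count) (auto intro!: mult_nonneg_nonneg sum_nonneg)
  also have "\<dots> = real n ^ 3"
    by (simp add: power3_eq_cube power2_eq_square)
  finally show ?thesis .
qed

section \<open>Dyadic blocks: mean squares and powers of their sums\<close>

definition dyadic_block :: "nat \<Rightarrow> real \<Rightarrow> real" where
  "dyadic_block j x = (\<Sum>l\<in>{2 ^ j..<2 ^ Suc j}. g_term x l)"

lemma dyadic_block_measurable [measurable]: "dyadic_block j \<in> borel_measurable borel"
  unfolding dyadic_block_def[abs_def] by measurable

lemma abs_dyadic_block_le_1: "\<bar>dyadic_block j x\<bar> \<le> 1"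
proof -
  have "\<bar>dyadic_block j x\<bar> \<le> (\<Sum>l\<in>{2 ^ j..<2 ^ Suc j}. \<bar>g_term x l\<bar>)"
    unfolding dyadic_block_def by (rule sum_abs)
  also have "\<dots> \<le> (\<Sum>l\<in>{2 ^ j..<2 ^ Suc j :: nat}. 1 / 2 ^ j)"
  proof (rule sum_mono)
    fix l :: nat assume "l \<in> {2 ^ j..<2 ^ Suc j}"
    then have "(2 ^ j :: real) \<le> real l"
      by (metis atLeastLessThan_iff of_nat_le_iff of_nat_numeral of_nat_power)
    then show "\<bar>g_term x l\<bar> \<le> 1 / 2 ^ j"
      unfolding g_term_eq_saw abs_divide by (intro frac_le) (auto simp: abs_saw_le)
  qed
  finally show ?thesis by simp
qed

text \<open>The first J blocks exhaust 1 <= l < 2^J, that is 2^J - 1 terms; block sums are thus a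
  subsequence of the partial sums defining \<open>g_fun\<close>.\<close>

lemma sum_dyadic_block: "(\<Sum>j<J. dyadic_block j x) = (\<Sum>l<2 ^ J - 1. g_term x (Suc l))"
proof -
  have "(\<Sum>j<J. dyadic_block j x) = (\<Sum>l\<in>{1..<2 ^ J}. g_term x l)"
  proof (induction J)
    case (Suc J)
    then show ?case
      using sum.atLeastLessThan_concat[of 1 "2 ^ J" "2 ^ Suc J" "g_term x"]
      by (simp add: dyadic_block_def)
  qed simp
  also have "\<dots> = (\<Sum>l<2 ^ J - 1. g_term x (Suc l))"
    by (simp add: sum.atLeast_Suc_lessThan_Suc_shift[symmetric] lessThan_atLeast0 sum.shift_bounds_Suc_ivl[symmetric])
  finally show ?thesis .
qed

text \<open>Expanding the square reduces the claim to the correlation bound and the gcd sum: the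
  result is n^3 / 2^(4 j) with n = 2^(j + 1).\<close>

lemma integral_dyadic_block_square:
  "(\<integral>x. indicator {0..<1} x * (dyadic_block j x)\<^sup>2 \<partial>lborel) \<le> 8 / 2 ^ j"
proof -
  define A where "A = {2 ^ j..<2 ^ Suc j :: nat}"
  have sub: "A \<subseteq> {1..2 ^ Suc j}"
    by (auto simp: A_def intro: order_trans[of _ "2 ^ j"])
  define c where "c l m x = indicator {0..<1} x * (saw (real l * x) * saw (real m * x)) / (real l * real m)"
    for l m and x :: real
  have c_int: "integrable lborel (c l m)" for l m
    unfolding c_def
  proof (intro integrable_divide integrable_indicator_bounded)
    show "\<bar>saw (real l * x) * saw (real m * x)\<bar> \<le> 1" for x
      unfolding abs_mult by (intro mult_le_one abs_saw_le abs_ge_zero)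
  qed auto
  have "indicator {0..<1} x * (dyadic_block j x)\<^sup>2 = (\<Sum>l\<in>A. \<Sum>m\<in>A. c l m x)" for x
  proof -
    have "(dyadic_block j x)\<^sup>2 = (\<Sum>l\<in>A. \<Sum>m\<in>A. g_term x l * g_term x m)"
      by (simp only: dyadic_block_def A_def power2_eq_square sum_product)
    then show ?thesis
      by (simp add: sum_distrib_left g_term_eq_saw c_def)
  qed
  then have "(\<integral>x. indicator {0..<1} x * (dyadic_block j x)\<^sup>2 \<partial>lborel) =
      (\<integral>x. (\<Sum>l\<in>A. \<Sum>m\<in>A. c l m x) \<partial>lborel)"
    by simp
  also have "\<dots> = (\<Sum>l\<in>A. \<Sum>m\<in>A. \<integral>x. c l m x \<partial>lborel)"
    using c_int by (simp add: Bochner_Integration.integral_sum)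
  \<comment> \<open>The product l m enters twice, once from the coefficients of the series and once
    from the correlation bound; each time it is at least 2^(2 j).\<close>
  also have "\<dots> \<le> (\<Sum>l\<in>A. \<Sum>m\<in>A. (real (gcd l m))\<^sup>2 / 2 ^ (4 * j))"
  proof (intro sum_mono)
    fix l m assume lm: "l \<in> A" "m \<in> A"
    then have pos: "l > 0" "m > 0"
      using sub by auto
    have ge: "(2 ^ j :: real) \<le> real l" "(2 ^ j :: real) \<le> real m"
      using lm unfolding A_def by (metis atLeastLessThan_iff of_nat_le_iff of_nat_numeral of_nat_power)+
    have "(\<integral>x. c l m x \<partial>lborel) \<le> (real (gcd l m))\<^sup>2 / (real l * real m) / (real l * real m)"
      unfolding c_def integral_divide_zero by (intro divide_right_mono integral_saw_mult_le pos) auto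
    also have "\<dots> = (real (gcd l m))\<^sup>2 / ((real l * real m) * (real l * real m))"
      by simp
    also have "\<dots> \<le> (real (gcd l m))\<^sup>2 / ((2 ^ j * 2 ^ j) * (2 ^ j * 2 ^ j))"
      using ge by (intro divide_left_mono mult_mono mult_pos_pos) (use pos in auto)
    also have "(2 ^ j * 2 ^ j) * (2 ^ j * 2 ^ j) = (2 ^ (4 * j) :: real)"
      by (simp flip: power_add)
    finally show "(\<integral>x. c l m x \<partial>lborel) \<le> (real (gcd l m))\<^sup>2 / 2 ^ (4 * j)" .
  qed
  also have "\<dots> \<le> (\<Sum>l\<in>{1..2 ^ Suc j}. \<Sum>m\<in>{1..2 ^ Suc j}. (real (gcd l m))\<^sup>2 / 2 ^ (4 * j))"
    by (rule order_trans[OF sum_mono2 sum_mono[OF sum_mono2]]) (use sub in \<open>auto intro: sum_nonneg\<close>)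
  also have "\<dots> \<le> real (2 ^ Suc j) ^ 3 / 2 ^ (4 * j)"
    unfolding sum_divide_distrib[symmetric] by (intro divide_right_mono sum_gcd_squares_le) auto
  also have "\<dots> = 8 / 2 ^ j"
    by (simp add: power_mult_distrib power_mult[symmetric] field_simps flip: power_add)
  finally show ?thesis .
qed

text \<open>A cheap substitute for convexity of the power function: bound every \<open>a j / w j\<close> by the \<open>L\<close>-th root
  of the sum on the right.\<close>

lemma power_sum_le_weighted:
  fixes a w :: "'a \<Rightarrow> real"
  assumes "finite A" "L > 0" and a: "\<And>j. j \<in> A \<Longrightarrow> 0 \<le> a j" and w: "\<And>j. j \<in> A \<Longrightarrow> 0 < w j"
  shows "(\<Sum>j\<in>A. a j) ^ L \<le> (\<Sum>j\<in>A. w j) ^ L * (\<Sum>j\<in>A. (a j / w j) ^ L)"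
proof -
  define Q where "Q = (\<Sum>j\<in>A. (a j / w j) ^ L)"
  have nonneg: "0 \<le> (a j / w j) ^ L" if "j \<in> A" for j
    using a[OF that] w[OF that] by simp
  have "a j \<le> w j * root L Q" if "j \<in> A" for j
  proof -
    have "(a j / w j) ^ L \<le> Q"
      unfolding Q_def using that nonneg by (intro member_le_sum[OF _ _ assms(1)]) auto
    then have "root L ((a j / w j) ^ L) \<le> root L Q"
      using assms(2) by simp
    then show ?thesis
      using a[OF that] w[OF that] assms(2) by (simp add: real_root_power_cancel pos_divide_le_eq mult.commute)
  qed
  then have "(\<Sum>j\<in>A. a j) \<le> (\<Sum>j\<in>A. w j) * root L Q"
    unfolding sum_distrib_right by (rule sum_mono)
  then have "(\<Sum>j\<in>A. a j) ^ L \<le> ((\<Sum>j\<in>A. w j) * root L Q) ^ L"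
    by (intro power_mono sum_nonneg a)
  also have "\<dots> = (\<Sum>j\<in>A. w j) ^ L * Q"
    using assms(2) nonneg by (simp add: power_mult_distrib Q_def sum_nonneg)
  finally show ?thesis unfolding Q_def .
qed

text \<open>The weights are \<open>(1 - 1 / (4 L)) ^ j\<close>: their sum is \<open>4 L\<close>, and Bernoulli's inequality
  bounds their \<open>(- L)\<close>-th powers by \<open>(4 / 3) ^ j\<close>.\<close>

lemma abs_sum_dyadic_block_power_le:
  assumes "L \<ge> 2"
  shows "\<bar>\<Sum>j<J. dyadic_block j x\<bar> ^ L \<le>
    (4 * real L) ^ L * (\<Sum>j<J. (4 / 3) ^ j * (dyadic_block j x)\<^sup>2)"
proof -
  define r where "r = 1 - 1 / (4 * real L)"
  have r: "0 < r" "r < 1"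
    using assms by (auto simp: r_def field_simps)
  have "1 + real L * (- (1 / (4 * real L))) \<le> (1 + - (1 / (4 * real L))) ^ L"
    using assms by (intro Bernoulli_inequality) (auto simp: field_simps)
  then have rL: "3 / 4 \<le> r ^ L"
    using assms by (simp add: r_def)
  have "(\<Sum>j<J. r ^ j) = (1 - r ^ J) / (1 - r)"
    using r by (simp add: sum_gp_strict)
  also have "\<dots> \<le> 1 / (1 - r)"
    using r by (intro divide_right_mono) auto
  also have "\<dots> = 4 * real L"
    by (simp add: r_def)
  finally have W: "(\<Sum>j<J. r ^ j) \<le> 4 * real L" .
  have "\<bar>\<Sum>j<J. dyadic_block j x\<bar> ^ L \<le> (\<Sum>j<J. \<bar>dyadic_block j x\<bar>) ^ L"
    by (intro power_mono sum_abs) auto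
  also have "\<dots> \<le> (\<Sum>j<J. r ^ j) ^ L * (\<Sum>j<J. (\<bar>dyadic_block j x\<bar> / r ^ j) ^ L)"
    using r assms by (intro power_sum_le_weighted) auto
  also have "\<dots> \<le> (4 * real L) ^ L * (\<Sum>j<J. (4 / 3) ^ j * (dyadic_block j x)\<^sup>2)"
  proof (intro mult_mono power_mono W sum_mono)
    fix j
    have "(\<bar>dyadic_block j x\<bar> / r ^ j) ^ L = (1 / r ^ L) ^ j * \<bar>dyadic_block j x\<bar> ^ L"
      by (simp add: power_divide mult.commute flip: power_mult)
    \<comment> \<open>Since the block is at most 1 in absolute value and L >= 2, the exponent L may
      be lowered to 2. The growth (4/3)^j is affordable against the decay 2^(-j) of the mean
      squares.\<close>
    also have "\<dots> \<le> (4 / 3) ^ j * \<bar>dyadic_block j x\<bar> ^ 2"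
    proof (intro mult_mono power_mono power_decreasing assms abs_dyadic_block_le_1)
      show "1 / r ^ L \<le> 4 / 3"
        using rL r by (simp add: field_simps)
    qed (use r in auto)
    finally show "(\<bar>dyadic_block j x\<bar> / r ^ j) ^ L \<le> (4 / 3) ^ j * (dyadic_block j x)\<^sup>2"
      by simp
  qed (use r in \<open>auto intro!: sum_nonneg\<close>)
  finally show ?thesis .
qed

section \<open>Moments of \<open>g_fun\<close>\<close>

text \<open>The bound for block sums is uniform in J and passes to the limit. Working in
  \<open>ennreal\<close> allows the right-hand series to be infinite, so the inequality can be
  stated for every x.\<close>

lemma abs_g_fun_power_le:
  assumes "L \<ge> 2"
  shows "ennreal (\<bar>g_fun x\<bar> ^ L) \<le>
    ennreal ((4 * real L) ^ L) * (\<Sum>j. ennreal ((4 / 3) ^ j * (dyadic_block j x)\<^sup>2))"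
proof (cases "summable (\<lambda>l. g_term x (Suc l))")
  case True
  have "(\<lambda>n. \<Sum>l<n. g_term x (Suc l)) \<longlonglongrightarrow> g_fun x"
    using True by (simp add: g_fun_def summable_LIMSEQ)
  moreover have "strict_mono (\<lambda>J. 2 ^ J - 1 :: nat)"
    by (rule strict_monoI) (simp add: diff_less_mono)
  ultimately have "(\<lambda>J. \<Sum>j<J. dyadic_block j x) \<longlonglongrightarrow> g_fun x"
    unfolding sum_dyadic_block using LIMSEQ_subseq_LIMSEQ by (fastforce simp: o_def)
  then have "(\<lambda>J. ennreal (\<bar>\<Sum>j<J. dyadic_block j x\<bar> ^ L)) \<longlonglongrightarrow> ennreal (\<bar>g_fun x\<bar> ^ L)"
    by (intro tendsto_ennrealI tendsto_power tendsto_rabs)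
  then show ?thesis
  proof (rule LIMSEQ_le_const2, intro exI[of _ 0] allI impI)
    fix J
    have "ennreal (\<bar>\<Sum>j<J. dyadic_block j x\<bar> ^ L) \<le>
        ennreal ((4 * real L) ^ L * (\<Sum>j<J. (4 / 3) ^ j * (dyadic_block j x)\<^sup>2))"
      by (intro ennreal_leI abs_sum_dyadic_block_power_le assms)
    also have "\<dots> = ennreal ((4 * real L) ^ L) * (\<Sum>j<J. ennreal ((4 / 3) ^ j * (dyadic_block j x)\<^sup>2))"
      by (subst sum_ennreal) (auto intro!: ennreal_mult'' sum_nonneg)
    also have "\<dots> \<le> ennreal ((4 * real L) ^ L) * (\<Sum>j. ennreal ((4 / 3) ^ j * (dyadic_block j x)\<^sup>2))"
      by (intro mult_left_mono sum_le_suminf) auto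
    finally show "ennreal (\<bar>\<Sum>j<J. dyadic_block j x\<bar> ^ L) \<le> \<dots>" .
  qed
next
  \<comment> \<open>Here \<open>g_fun x\<close> has its default value 0, and 0^L = 0 because L is
    positive.\<close>
  case False
  then show ?thesis
    using assms by (simp add: g_fun_def power_0_left)
qed

lemma nn_integral_dyadic_block_square:
  "(\<integral>\<^sup>+ x \<in> {0..1}. ennreal ((dyadic_block j x)\<^sup>2) \<partial>lborel) \<le> ennreal (8 / 2 ^ j)"
proof -
  \<comment> \<open>The closed interval exceeds the half-open one, which was convenient for
    translations, only by the null point 1.\<close>
  have "AE x in lborel. x \<noteq> (1::real)"
    by (rule AE_lborel_singleton)
  then have "(\<integral>\<^sup>+ x \<in> {0..1}. ennreal ((dyadic_block j x)\<^sup>2) \<partial>lborel) =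
      (\<integral>\<^sup>+ x. ennreal (indicator {0..<1} x * (dyadic_block j x)\<^sup>2) \<partial>lborel)"
    by (intro nn_integral_cong_AE) (auto simp: indicator_def elim!: eventually_mono)
  also have "\<dots> = ennreal (\<integral>x. indicator {0..<1} x * (dyadic_block j x)\<^sup>2 \<partial>lborel)"
  proof (intro nn_integral_eq_integral integrable_indicator_bounded)
    show "\<bar>(dyadic_block j x)\<^sup>2\<bar> \<le> 1" for x
      using abs_dyadic_block_le_1[of j x] by (simp add: abs_square_le_1)
  qed auto
  also have "\<dots> \<le> ennreal (8 / 2 ^ j)"
    by (intro ennreal_leI integral_dyadic_block_square)
  finally show ?thesis .
qed

lemma nn_integral_abs_g_fun_power_le:
  assumes "L \<ge> 2"
  shows "(\<integral>\<^sup>+ x \<in> {0..1}. ennreal (\<bar>g_fun x\<bar> ^ L) \<partial>lborel) \<le> ennreal (24 * (4 * real L) ^ L)"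
proof -
  let ?h = "\<lambda>j x. ennreal ((4 / 3) ^ j) * (ennreal ((dyadic_block j x)\<^sup>2) * indicator {0..1} x)"
  have "(\<integral>\<^sup>+ x \<in> {0..1}. ennreal (\<bar>g_fun x\<bar> ^ L) \<partial>lborel) \<le>
      (\<integral>\<^sup>+ x. ennreal ((4 * real L) ^ L) * (\<Sum>j. ?h j x) \<partial>lborel)"
  proof (rule nn_integral_mono)
    fix x
    show "ennreal (\<bar>g_fun x\<bar> ^ L) * indicator {0..1} x \<le> ennreal ((4 * real L) ^ L) * (\<Sum>j. ?h j x)"
      using abs_g_fun_power_le[OF assms, of x] by (auto simp: indicator_def ennreal_mult)
  qed
  \<comment> \<open>Monotone convergence allows termwise integration of the nonnegative
    series.\<close>
  also have "\<dots> = ennreal ((4 * real L) ^ L) * (\<Sum>j. \<integral>\<^sup>+ x. ?h j x \<partial>lborel)"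
    by (simp add: nn_integral_cmult nn_integral_suminf)
  also have "\<dots> \<le> ennreal ((4 * real L) ^ L) * (\<Sum>j. ennreal (8 * (2 / 3) ^ j))"
  proof (intro mult_left_mono suminf_le)
    fix j
    have "(\<integral>\<^sup>+ x. ?h j x \<partial>lborel) =
        ennreal ((4 / 3) ^ j) * (\<integral>\<^sup>+ x \<in> {0..1}. ennreal ((dyadic_block j x)\<^sup>2) \<partial>lborel)"
      by (rule nn_integral_cmult) simp
    also have "\<dots> \<le> ennreal ((4 / 3) ^ j) * ennreal (8 / 2 ^ j)"
      by (intro mult_left_mono nn_integral_dyadic_block_square) auto
    also have "\<dots> = ennreal (8 * ((4 / 3) ^ j / 2 ^ j))"
      by (simp flip: ennreal_mult)
    also have "(4 / 3) ^ j / 2 ^ j = (2 / 3 :: real) ^ j"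
      by (simp flip: power_divide)
    finally show "(\<integral>\<^sup>+ x. ?h j x \<partial>lborel) \<le> ennreal (8 * (2 / 3) ^ j)" .
  qed auto
  \<comment> \<open>The value is 8 / (1 - 2/3) = 24.\<close>
  also have "(\<Sum>j. ennreal (8 * (2 / 3) ^ j)) = ennreal 24"
  proof (rule suminf_ennreal_eq)
    show "(\<lambda>j. 8 * (2 / 3) ^ j) sums (24::real)"
      using sums_mult[OF geometric_sums[of "2 / 3 :: real"], of 8] by simp
  qed simp
  also have "ennreal ((4 * real L) ^ L) * ennreal 24 = ennreal (24 * (4 * real L) ^ L)"
    by (subst ennreal_mult''[symmetric]) (auto simp: mult.commute)
  finally show ?thesis .
qed

theorem theorem1p1:
  "\<exists>C0::real. C0 > 0 \<and>
     (\<forall>L::nat. (\<integral>\<^sup>+ x \<in> {0..1}. ennreal (\<bar>g_fun x\<bar> ^ L) \<partial>lborel) \<le> ennreal (C0 ^ L * real L ^ L))"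
proof (intro exI[of _ "2000 :: real"] conjI allI)
  \<comment> \<open>The constant 2000 is a round bound for all cases: L >= 2 needs 24 * 4 = 96, and
    L = 1 needs 1 + 24 * 8^2 = 1537.\<close>
  fix L :: nat
  consider "L = 0" | "L = 1" | "L \<ge> 2" by linarith
  then show "(\<integral>\<^sup>+ x \<in> {0..1}. ennreal (\<bar>g_fun x\<bar> ^ L) \<partial>lborel) \<le> ennreal (2000 ^ L * real L ^ L)"
  proof cases
    \<comment> \<open>With 0^0 = 1, both sides equal 1.\<close>
    assume "L = 0"
    then show ?thesis by simp
  next
    assume L: "L = 1"
    \<comment> \<open>The moment bound starts at exponent 2, so the first moment is controlled by
      the second.\<close>
    have le: "\<bar>y\<bar> \<le> 1 + \<bar>y\<bar>\<^sup>2" for y :: real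
      using zero_le_power2[of "\<bar>y\<bar> - 1 / 2"] by (simp add: power2_eq_square algebra_simps)
    have "(\<integral>\<^sup>+ x \<in> {0..1}. ennreal \<bar>g_fun x\<bar> \<partial>lborel) \<le>
        (\<integral>\<^sup>+ x. indicator {0..1} x + ennreal (\<bar>g_fun x\<bar>\<^sup>2) * indicator {0..1} x \<partial>lborel)"
    proof (rule nn_integral_mono)
      fix x
      have "ennreal \<bar>g_fun x\<bar> \<le> ennreal (1 + \<bar>g_fun x\<bar>\<^sup>2)"
        by (intro ennreal_leI le)
      also have "\<dots> = 1 + ennreal (\<bar>g_fun x\<bar>\<^sup>2)"
        by (subst ennreal_plus) auto
      finally show "ennreal \<bar>g_fun x\<bar> * indicator {0..1} x \<le>
          indicator {0..1} x + ennreal (\<bar>g_fun x\<bar>\<^sup>2) * indicator {0..1} x"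
        by (auto simp: indicator_def)
    qed
    also have "\<dots> = 1 + (\<integral>\<^sup>+ x \<in> {0..1}. ennreal (\<bar>g_fun x\<bar>\<^sup>2) \<partial>lborel)"
      by (subst nn_integral_add) auto
    also have "\<dots> \<le> ennreal 1 + ennreal (24 * (4 * real 2) ^ 2)"
      using nn_integral_abs_g_fun_power_le[of 2] by (intro add_mono) auto
    also have "\<dots> = ennreal 1537"
      by (subst ennreal_plus[symmetric]) auto
    also have "\<dots> \<le> ennreal 2000"
      by (rule ennreal_leI) simp
    finally show ?thesis
      using L by simp
  next
    assume L: "L \<ge> 2"
    \<comment> \<open>The constant in front is absorbed into the L-th power.\<close>
    have "24 * (4 * real L) ^ L \<le> 24 ^ L * (4 * real L) ^ L"
      using L power_increasing[of 1 L "24 :: real"] by (intro mult_right_mono) auto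
    also have "\<dots> = 96 ^ L * real L ^ L"
      by (simp add: power_mult_distrib mult.assoc flip: power_mult_distrib[of 24])
    also have "\<dots> \<le> 2000 ^ L * real L ^ L"
      by (intro mult_right_mono power_mono) auto
    finally show ?thesis
      using nn_integral_abs_g_fun_power_le[OF L] by (meson ennreal_leI order_trans)
  qed
qed simp

end
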